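(* Let $A$ and $B$ be Banach algebras. Then both of the following equivalences hold. (i) The direct product $A\oplus B$ is cyclic amenable if and only if $A$ and $B$ are cyclic amenable and, in addition, $A^2$ is dense in $A$ or $B^2$ is dense in $B$. (ii) The direct product $A\oplus B$ is approximately cyclic amenable if and only if $A$ and $B$ are approximately cyclic amenable and, in addition, $A^2$ is dense in $A$ or $B^2$ is dense in $B$.
   Context: Banach algebras are over $\mathbb{C}$, not assumed commutative or unital. For a Banach algebra $A$, $A^2$ denotes the linear span of $\{ac : a,c\in A\}$. The direct product $A\oplus B$ is $A\times B$ with coordinatewise operations, including coordinatewise multiplication $(a,b)(a',b')=(aa',bb')$, and norm $\|(a,b)\|=\|a\|+\|b\|$. For a Banach algebra $A$, the dual $A^*$ is a Banach $A$-bimodule via $(fa)(x)=f(ax)$ and $(af)(x)=f(xa)$ for $a,x\in A$, $f\in A^*$. A derivation $D:A\to A^*$ is a linear map with $D(ac)=D(a)c+aD(c)$ for all $a,c\in A$. It is cyclic if $D(a)(c)+D(c)(a)=0$ for all $a,c\in A$. For $f\in A^*$ let $d_f(a)=af-fa$. $D$ is inner if $D=d_f$ for some $f\in A^*$, and approximately inner if there is a net $(f_\alpha)$ in $A^*$ with $D=\lim_\alpha d_{f_\alpha}$ in the strong operator topology, i.e. $\|D(a)-d_{f_\alpha}(a)\|\to 0$ for every $a\in A$. $A$ is cyclic amenable (respectively, approximately cyclic amenable) if every continuous cyclic derivation $D:A\to A^*$ is inner (respectively, approximately inner). *)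

theory Defs
  imports "HOL-Analysis.Analysis"
begin

section \<open>Complex Banach algebras\<close>

text \<open>
  \<^class>\<open>real_normed_algebra\<close> is neither unital nor commutative and allows the zero algebra.
  The complex scalar multiplication extends the real one of the superclass.
\<close>

class scaleC =
  fixes scaleC :: "complex \<Rightarrow> 'a \<Rightarrow> 'a"  (infixr "*\<^sub>C" 75)

class complex_banach_algebra = real_normed_algebra + banach + scaleC +
  assumes scaleC_add_right: "c *\<^sub>C (x + y) = c *\<^sub>C x + c *\<^sub>C y"
    and scaleC_add_left: "(c + d) *\<^sub>C x = c *\<^sub>C x + d *\<^sub>C x"
    and scaleC_scaleC: "c *\<^sub>C (d *\<^sub>C x) = (c * d) *\<^sub>C x"
    and scaleC_of_real: "of_real r *\<^sub>C x = r *\<^sub>R x"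
    and scaleC_mult_left: "(c *\<^sub>C x) * y = c *\<^sub>C (x * y)"
    and scaleC_mult_right: "x * (c *\<^sub>C y) = c *\<^sub>C (x * y)"
    and norm_scaleC: "norm (c *\<^sub>C x) = cmod c * norm x"

global_interpretation complex_vector:
  vector_space "scaleC :: complex \<Rightarrow> 'a \<Rightarrow> 'a::complex_banach_algebra"
proof
  fix x :: 'a
  show "1 *\<^sub>C x = x"
    using scaleC_of_real[of 1 x] by simp
qed (simp_all add: scaleC_add_right scaleC_add_left scaleC_scaleC)

instantiation complex :: complex_banach_algebra
begin

definition scaleC_complex :: "complex \<Rightarrow> complex \<Rightarrow> complex" where
  "scaleC_complex c x = c * x"

instance
  by standard (simp_all add: scaleC_complex_def algebra_simps norm_mult scaleR_conv_of_real)

end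


section \<open>The direct product\<close>

text \<open>
  A copy of the product type, because the library equips \<^typ>\<open>'a \<times> 'b\<close> with the Euclidean
  combination of the two norms instead of their sum.
\<close>

datatype ('a, 'b) direct_product (infixr "\<oplus>" 20) = DP (dp_fst: 'a) (dp_snd: 'b)

lemma dp_eq_iff: "x = y \<longleftrightarrow> dp_fst x = dp_fst y \<and> dp_snd x = dp_snd y"
  by (cases x; cases y) simp

instantiation direct_product :: (real_normed_algebra, real_normed_algebra) real_normed_algebra
begin

definition zero_direct_product :: "'a \<oplus> 'b" where
  "0 = DP 0 0"

definition plus_direct_product :: "'a \<oplus> 'b \<Rightarrow> 'a \<oplus> 'b \<Rightarrow> 'a \<oplus> 'b" where
  "x + y = DP (dp_fst x + dp_fst y) (dp_snd x + dp_snd y)"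

definition minus_direct_product :: "'a \<oplus> 'b \<Rightarrow> 'a \<oplus> 'b \<Rightarrow> 'a \<oplus> 'b" where
  "x - y = DP (dp_fst x - dp_fst y) (dp_snd x - dp_snd y)"

definition uminus_direct_product :: "'a \<oplus> 'b \<Rightarrow> 'a \<oplus> 'b" where
  "- x = DP (- dp_fst x) (- dp_snd x)"

definition times_direct_product :: "'a \<oplus> 'b \<Rightarrow> 'a \<oplus> 'b \<Rightarrow> 'a \<oplus> 'b" where
  "x * y = DP (dp_fst x * dp_fst y) (dp_snd x * dp_snd y)"

definition scaleR_direct_product :: "real \<Rightarrow> 'a \<oplus> 'b \<Rightarrow> 'a \<oplus> 'b" where
  "r *\<^sub>R x = DP (r *\<^sub>R dp_fst x) (r *\<^sub>R dp_snd x)"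

definition norm_direct_product :: "'a \<oplus> 'b \<Rightarrow> real" where
  "norm x = norm (dp_fst x) + norm (dp_snd x)"

definition sgn_direct_product_def:
  "sgn (x :: 'a \<oplus> 'b) = inverse (norm x) *\<^sub>R x"

definition dist_direct_product_def:
  "dist (x :: 'a \<oplus> 'b) y = norm (x - y)"

definition uniformity_direct_product_def:
  "(uniformity :: (('a \<oplus> 'b) \<times> ('a \<oplus> 'b)) filter) =
    (INF e\<in>{0<..}. principal {(x :: 'a \<oplus> 'b, y). dist x y < e})"

definition open_direct_product_def:
  "open (U :: ('a \<oplus> 'b) set) \<longleftrightarrow> (\<forall>x\<in>U. eventually (\<lambda>(x', y). x' = x \<longrightarrow> y \<in> U) uniformity)"

lemmas dp_alg_defs = zero_direct_product_def plus_direct_product_def minus_direct_product_def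
  uminus_direct_product_def times_direct_product_def scaleR_direct_product_def

instance
proof
  fix x y z :: "'a \<oplus> 'b" and r s :: real and U :: "('a \<oplus> 'b) set"
  show "x + y + z = x + (y + z)" "x + y = y + x" "0 + x = x" "- x + x = 0" "x - y = x + - y"
    by (simp_all add: dp_alg_defs algebra_simps)
  show "r *\<^sub>R (x + y) = r *\<^sub>R x + r *\<^sub>R y" "(r + s) *\<^sub>R x = r *\<^sub>R x + s *\<^sub>R x"
    "r *\<^sub>R s *\<^sub>R x = (r * s) *\<^sub>R x" "1 *\<^sub>R x = x"
    by (simp_all add: dp_alg_defs algebra_simps)
  show "x * y * z = x * (y * z)" "(x + y) * z = x * z + y * z" "x * (y + z) = x * y + x * z"
    by (simp_all add: dp_alg_defs algebra_simps)
  show "r *\<^sub>R x * y = r *\<^sub>R (x * y)" "x * r *\<^sub>R y = r *\<^sub>R (x * y)"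
    by (simp_all add: dp_alg_defs)
  show "dist x y = norm (x - y)"
    by (simp add: dist_direct_product_def)
  show "sgn x = inverse (norm x) *\<^sub>R x"
    by (simp add: sgn_direct_product_def)
  show "(uniformity :: (('a \<oplus> 'b) \<times> ('a \<oplus> 'b)) filter)
      = (INF e\<in>{0<..}. principal {(x, y). dist x y < e})"
    by (simp add: uniformity_direct_product_def)
  show "open U \<longleftrightarrow> (\<forall>x\<in>U. \<forall>\<^sub>F (x', y) in uniformity. x' = x \<longrightarrow> y \<in> U)"
    by (simp add: open_direct_product_def)
  show "norm x = 0 \<longleftrightarrow> x = 0"
    by (simp add: norm_direct_product_def dp_alg_defs dp_eq_iff add_nonneg_eq_0_iff)
  show "norm (x + y) \<le> norm x + norm y"
    using norm_triangle_ineq[of "dp_fst x" "dp_fst y"] norm_triangle_ineq[of "dp_snd x" "dp_snd y"]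
    by (simp add: norm_direct_product_def dp_alg_defs)
  show "norm (r *\<^sub>R x) = \<bar>r\<bar> * norm x"
    by (simp add: norm_direct_product_def dp_alg_defs algebra_simps)
  show "norm (x * y) \<le> norm x * norm y"
  proof -
    have "norm (x * y) \<le> norm (dp_fst x) * norm (dp_fst y) + norm (dp_snd x) * norm (dp_snd y)"
      by (simp add: norm_direct_product_def dp_alg_defs add_mono norm_mult_ineq)
    also have "\<dots> \<le> norm x * norm y"
      by (simp add: norm_direct_product_def algebra_simps)
    finally show ?thesis .
  qed
qed

end

lemma dist_dp: "dist x y = dist (dp_fst x) (dp_fst y) + dist (dp_snd x) (dp_snd y)"
  for x y :: "'a::real_normed_algebra \<oplus> 'b::real_normed_algebra"
  by (simp add: dist_direct_product_def norm_direct_product_def dp_alg_defs dist_norm)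

instance direct_product :: ("{real_normed_algebra, banach}", "{real_normed_algebra, banach}") banach
proof
  fix X :: "nat \<Rightarrow> 'a \<oplus> 'b"
  assume X: "Cauchy X"
  have le: "dist (dp_fst x) (dp_fst y) \<le> dist x y" "dist (dp_snd x) (dp_snd y) \<le> dist x y"
    for x y :: "'a \<oplus> 'b"
    by (simp_all add: dist_dp)
  have "Cauchy (\<lambda>n. dp_fst (X n))" "Cauchy (\<lambda>n. dp_snd (X n))"
    using X le unfolding Cauchy_def by (meson le_less_trans)+
  then obtain a b where "(\<lambda>n. dp_fst (X n)) \<longlonglongrightarrow> a" "(\<lambda>n. dp_snd (X n)) \<longlonglongrightarrow> b"
    by (meson Cauchy_convergent_iff convergent_def)
  then have "(\<lambda>n. dist (dp_fst (X n)) a + dist (dp_snd (X n)) b) \<longlonglongrightarrow> 0 + 0"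
    by (intro tendsto_add) (simp_all flip: tendsto_dist_iff)
  then have "X \<longlonglongrightarrow> DP a b"
    by (subst tendsto_dist_iff) (simp add: dist_dp)
  then show "convergent X"
    by (rule convergentI)
qed

instantiation direct_product :: (complex_banach_algebra, complex_banach_algebra) complex_banach_algebra
begin

definition scaleC_direct_product :: "complex \<Rightarrow> 'a \<oplus> 'b \<Rightarrow> 'a \<oplus> 'b" where
  "c *\<^sub>C x = DP (c *\<^sub>C dp_fst x) (c *\<^sub>C dp_snd x)"

instance
  by standard
    (simp_all add: dp_alg_defs scaleC_direct_product_def norm_direct_product_def scaleC_add_right
      scaleC_add_left scaleC_scaleC scaleC_of_real scaleC_mult_left scaleC_mult_right norm_scaleC
      distrib_left)

end


section \<open>The dual bimodule\<close>

text \<open>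
  \<^typ>\<open>'a \<Rightarrow>\<^sub>L complex\<close> consists of the bounded real-linear maps with the operator norm; the dual
  is its subspace of complex-linear functionals.
\<close>

definition dual :: "('a::complex_banach_algebra \<Rightarrow>\<^sub>L complex) set" where
  "dual = {f. \<forall>c x. blinfun_apply f (c *\<^sub>C x) = c * blinfun_apply f x}"

definition dual_rmult :: "('a::complex_banach_algebra \<Rightarrow>\<^sub>L complex) \<Rightarrow> 'a \<Rightarrow> ('a \<Rightarrow>\<^sub>L complex)"
    (infixl "\<triangleleft>" 70) where
  "f \<triangleleft> a = f o\<^sub>L blinfun_mult_right a"

definition dual_lmult :: "'a::complex_banach_algebra \<Rightarrow> ('a \<Rightarrow>\<^sub>L complex) \<Rightarrow> ('a \<Rightarrow>\<^sub>L complex)"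
    (infixr "\<triangleright>" 70) where
  "a \<triangleright> f = f o\<^sub>L blinfun_mult_left a"

lemma dual_mult_apply [simp]: "(f \<triangleleft> a) x = f (a * x)" "(a \<triangleright> f) x = f (x * a)"
  by (simp_all add: dual_rmult_def dual_lmult_def)

lemma dual_mult_in_dual: "f \<in> dual \<Longrightarrow> f \<triangleleft> a \<in> dual" "f \<in> dual \<Longrightarrow> a \<triangleright> f \<in> dual"
  by (simp_all add: dual_def scaleC_mult_left scaleC_mult_right)


section \<open>Derivations and cyclic amenability\<close>

definition derivation :: "('a::complex_banach_algebra \<Rightarrow> ('a \<Rightarrow>\<^sub>L complex)) \<Rightarrow> bool" where
  "derivation D \<longleftrightarrow>
     (\<forall>a. D a \<in> dual) \<and>
     (\<forall>a b. D (a + b) = D a + D b) \<and>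
     (\<forall>c a x. D (c *\<^sub>C a) x = c * D a x) \<and>
     (\<forall>a b. D (a * b) = D a \<triangleleft> b + a \<triangleright> D b)"

definition cyclic :: "('a::complex_banach_algebra \<Rightarrow> ('a \<Rightarrow>\<^sub>L complex)) \<Rightarrow> bool" where
  "cyclic D \<longleftrightarrow> (\<forall>a b. D a b + D b a = 0)"

definition inner_derivation ::
    "('a::complex_banach_algebra \<Rightarrow>\<^sub>L complex) \<Rightarrow> 'a \<Rightarrow> ('a \<Rightarrow>\<^sub>L complex)" where
  "inner_derivation f a = a \<triangleright> f - f \<triangleleft> a"

definition is_inner :: "('a::complex_banach_algebra \<Rightarrow> ('a \<Rightarrow>\<^sub>L complex)) \<Rightarrow> bool" where
  "is_inner D \<longleftrightarrow> (\<exists>f\<in>dual. D = inner_derivation f)"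

text \<open>
  Nets in the dual are rendered by proper filters concentrated on the dual. The two lemmas below
  show that this is the same as convergence along some net over a directed set.
\<close>

definition approximately_inner :: "('a::complex_banach_algebra \<Rightarrow> ('a \<Rightarrow>\<^sub>L complex)) \<Rightarrow> bool" where
  "approximately_inner D \<longleftrightarrow>
     (\<exists>F. F \<noteq> bot \<and> (\<forall>\<^sub>F f in F. f \<in> dual) \<and>
       (\<forall>a. ((\<lambda>f. norm (D a - inner_derivation f a)) \<longlongrightarrow> 0) F))"

definition net_approximates ::
    "'i set \<Rightarrow> ('i \<Rightarrow> 'i \<Rightarrow> bool) \<Rightarrow> ('i \<Rightarrow> ('a::complex_banach_algebra \<Rightarrow>\<^sub>L complex)) \<Rightarrow>
      ('a \<Rightarrow> ('a \<Rightarrow>\<^sub>L complex)) \<Rightarrow> bool" where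
  "net_approximates I le \<phi> D \<longleftrightarrow>
     I \<noteq> {} \<and> reflp_on I le \<and> transp_on I le \<and> (\<forall>i\<in>I. \<forall>j\<in>I. \<exists>k\<in>I. le i k \<and> le j k) \<and>
     (\<forall>i\<in>I. \<phi> i \<in> dual) \<and>
     (\<forall>a. \<forall>e>0. \<exists>i\<in>I. \<forall>j\<in>I. le i j \<longrightarrow> norm (D a - inner_derivation (\<phi> j) a) < e)"

lemma approximately_inner_if_net:
  assumes "net_approximates I le \<phi> D"
  shows "approximately_inner D"
proof -
  define B where "B i = principal (\<phi> ` {j\<in>I. le i j})" for i
  define F where "F = (INF i\<in>I. B i)"
  have ev: "eventually P F \<longleftrightarrow> (\<exists>i\<in>I. \<forall>j\<in>I. le i j \<longrightarrow> P (\<phi> j))" for P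
  proof -
    have "eventually P F \<longleftrightarrow> (\<exists>i\<in>I. eventually P (B i))"
      unfolding F_def
    proof (rule eventually_INF_base)
      show "I \<noteq> {}"
        using assms by (simp add: net_approximates_def)
      fix i j assume ij: "i \<in> I" "j \<in> I"
      then obtain k where "k \<in> I" "le i k" "le j k"
        using assms unfolding net_approximates_def by blast
      moreover have "transp_on I le"
        using assms by (simp add: net_approximates_def)
      ultimately show "\<exists>k\<in>I. B k \<le> inf (B i) (B j)"
        using ij by (intro bexI[of _ k]) (auto simp: B_def dest: transp_onD)
    qed
    then show ?thesis
      by (auto simp: B_def eventually_principal)
  qed
  show ?thesis
    unfolding approximately_inner_def
  proof (intro exI[of _ F] conjI allI)
    have "\<not> eventually (\<lambda>_. False) F"
      using assms unfolding ev net_approximates_def reflp_on_def by blast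
    then show "F \<noteq> bot"
      by (auto simp: trivial_limit_def)
    show "\<forall>\<^sub>F f in F. f \<in> dual"
      using assms unfolding ev net_approximates_def by blast
    show "((\<lambda>f. norm (D a - inner_derivation f a)) \<longlongrightarrow> 0) F" for a
      using assms unfolding tendsto_iff ev net_approximates_def by simp
  qed
qed

lemma net_if_approximately_inner:
  fixes D :: "'a::complex_banach_algebra \<Rightarrow> ('a \<Rightarrow>\<^sub>L complex)"
  assumes "approximately_inner D"
  shows "\<exists>(I :: (('a \<Rightarrow>\<^sub>L complex) \<times> ('a \<Rightarrow>\<^sub>L complex) set) set) le \<phi>. net_approximates I le \<phi> D"
proof -
  obtain F where F: "F \<noteq> bot" "\<forall>\<^sub>F f in F. f \<in> dual"
    "\<And>a. ((\<lambda>f. norm (D a - inner_derivation f a)) \<longlongrightarrow> 0) F"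
    using assms unfolding approximately_inner_def by blast
  define I where "I = {(f, S). f \<in> S \<and> S \<subseteq> dual \<and> (\<forall>\<^sub>F g in F. g \<in> S)}"
  define le where "le i j \<longleftrightarrow> snd j \<subseteq> snd i"
    for i j :: "('a \<Rightarrow>\<^sub>L complex) \<times> ('a \<Rightarrow>\<^sub>L complex) set"
  have point: "\<exists>f. (f, S) \<in> I" if "S \<subseteq> dual" "\<forall>\<^sub>F g in F. g \<in> S" for S
    using that eventually_happens'[OF F(1) that(2)] by (auto simp: I_def)
  have "net_approximates I le fst D"
    unfolding net_approximates_def
  proof (intro conjI ballI allI impI)
    show "I \<noteq> {}"
      using point[of dual] F(2) by auto
    show "reflp_on I le" "transp_on I le"
      by (auto simp: le_def reflp_on_def transp_on_def)
    show "fst i \<in> dual" if "i \<in> I" for i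
      using that by (auto simp: I_def)
    show "\<exists>k\<in>I. le i k \<and> le j k" if "i \<in> I" "j \<in> I" for i j
    proof -
      have "snd i \<inter> snd j \<subseteq> dual" "\<forall>\<^sub>F g in F. g \<in> snd i \<inter> snd j"
        using that by (auto simp: I_def eventually_conj)
      from point[OF this] obtain f where "(f, snd i \<inter> snd j) \<in> I" ..
      then show ?thesis
        by (intro bexI[of _ "(f, snd i \<inter> snd j)"]) (auto simp: le_def)
    qed
    show "\<exists>i\<in>I. \<forall>j\<in>I. le i j \<longrightarrow> norm (D a - inner_derivation (fst j) a) < e" if "e > 0" for a e
    proof -
      define S where "S = {f\<in>dual. norm (D a - inner_derivation f a) < e}"
      have "\<forall>\<^sub>F g in F. g \<in> S"
        using F(2) tendstoD[OF F(3) \<open>e > 0\<close>, of a] by eventually_elim (simp add: S_def)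
      then obtain f where "(f, S) \<in> I"
        using point[of S] by (auto simp: S_def)
      then show ?thesis
        by (intro bexI[of _ "(f, S)"]) (auto simp: le_def I_def S_def)
    qed
  qed
  then show ?thesis
    by blast
qed

definition cyclic_amenable :: "'a::complex_banach_algebra itself \<Rightarrow> bool" where
  "cyclic_amenable _ \<longleftrightarrow>
     (\<forall>D :: 'a \<Rightarrow> ('a \<Rightarrow>\<^sub>L complex).
        derivation D \<and> cyclic D \<and> continuous_on UNIV D \<longrightarrow> is_inner D)"

definition approximately_cyclic_amenable :: "'a::complex_banach_algebra itself \<Rightarrow> bool" where
  "approximately_cyclic_amenable _ \<longleftrightarrow>
     (\<forall>D :: 'a \<Rightarrow> ('a \<Rightarrow>\<^sub>L complex).
        derivation D \<and> cyclic D \<and> continuous_on UNIV D \<longrightarrow> approximately_inner D)"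

definition square :: "'a::complex_banach_algebra set" where
  "square = complex_vector.span {a * c |a c. True}"

definition square_dense :: "'a::complex_banach_algebra itself \<Rightarrow> bool" where
  "square_dense _ \<longleftrightarrow> closure (square :: 'a set) = UNIV"

end

theory Submission
  imports Defs
begin

text \<open>
  A continuous cyclic derivation on the direct product splits into its restrictions to the two
  factors and two mixed terms. Since the factors annihilate each other, a mixed term vanishes on
  squares, so it vanishes as soon as one square is dense (cyclicity transfers this to the other
  mixed term). Conversely, functionals \<open>f\<close> and \<open>g\<close> that vanish on the squares
  give the cyclic derivation \<open>(a, b) \<mapsto> f a \<cdot> g - g b \<cdot> f\<close>, which
  consists of mixed terms only, while every inner derivation has none. Such functionals come from
  the Hahn-Banach theorem, which is obtained from the fact that a minimal sublinear functional is
  linear.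
\<close>

section \<open>The Hahn-Banach theorem\<close>

text \<open>Scaling is demanded only as an inequality, which infima of functionals satisfy directly;
  equality for r \<ge> 0 is recovered in \<open>sublinear_scaleR\<close> by scaling back with 1 /
  r.\<close>

definition sublinear :: "('a::real_vector \<Rightarrow> real) \<Rightarrow> bool" where
  "sublinear q \<longleftrightarrow> (\<forall>x y. q (x + y) \<le> q x + q y) \<and> (\<forall>r\<ge>0. \<forall>x. q (r *\<^sub>R x) \<le> r * q x)"

lemma sublinear_add: "sublinear q \<Longrightarrow> q (x + y) \<le> q x + q y"
  by (simp add: sublinear_def)

lemma sublinear_zero:
  assumes "sublinear q"
  shows "q 0 = 0"
proof -
  have "q (0 *\<^sub>R 0) \<le> 0 * q 0"
    using assms unfolding sublinear_def by blast
  then show ?thesis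
    using sublinear_add[OF assms, of 0 0] by simp
qed

lemma sublinear_scaleR:
  assumes "sublinear q" "0 \<le> r"
  shows "q (r *\<^sub>R x) = r * q x"
proof (cases "r = 0")
  case True
  then show ?thesis
    using sublinear_zero[OF assms(1)] by simp
next
  case False
  have "q ((1 / r) *\<^sub>R (r *\<^sub>R x)) \<le> (1 / r) * q (r *\<^sub>R x)"
    using assms unfolding sublinear_def by (meson divide_nonneg_nonneg zero_le_one)
  then have "r * q x \<le> q (r *\<^sub>R x)"
    using False assms(2) by (simp add: field_simps)
  moreover have "q (r *\<^sub>R x) \<le> r * q x"
    using assms by (simp add: sublinear_def)
  ultimately show ?thesis
    by simp
qed

lemma sublinear_minus: "sublinear q \<Longrightarrow> - q (- x) \<le> q x"
  using sublinear_add[of q x "- x"] sublinear_zero[of q] by simp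

text \<open>With h = 1 / t the term is the difference quotient (q (y + h x) - q y) / h, so for
  sublinear \<open>q\<close> this is the one-sided directional derivative of \<open>q\<close> at
  \<open>y\<close> in direction \<open>x\<close>. The parameter t = 0 contributes \<open>q x\<close>
  itself; t = 1 shows that the value at \<open>- y\<close> is at most \<open>- q y\<close>.\<close>

definition slope_along :: "('a::real_vector \<Rightarrow> real) \<Rightarrow> 'a \<Rightarrow> 'a \<Rightarrow> real" where
  "slope_along q y x = (INF t\<in>{0..}. q (x + t *\<^sub>R y) - t * q y)"

text \<open>A real infimum can be trusted only over a set bounded below. Subadditivity supplies the
  bound \<open>- q (- x)\<close>, which is uniform in \<open>t\<close>.\<close>

lemma slope_along_bdd:
  assumes "sublinear q"
  shows "bdd_below ((\<lambda>t. q (x + t *\<^sub>R y) - t * q y) ` {0..})"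
proof (rule bdd_belowI2)
  fix t :: real assume "t \<in> {0..}"
  then have "t * q y = q ((x + t *\<^sub>R y) + - x)"
    using sublinear_scaleR[OF assms] by simp
  also have "\<dots> \<le> q (x + t *\<^sub>R y) + q (- x)"
    using assms by (rule sublinear_add)
  finally show "- q (- x) \<le> q (x + t *\<^sub>R y) - t * q y"
    by simp
qed

lemma slope_along_le:
  assumes "sublinear q" "0 \<le> t"
  shows "slope_along q y x \<le> q (x + t *\<^sub>R y) - t * q y"
  unfolding slope_along_def using assms slope_along_bdd by (intro cINF_lower) auto

lemma slope_along_greatest:
  "(\<And>t. 0 \<le> t \<Longrightarrow> c \<le> q (x + t *\<^sub>R y) - t * q y) \<Longrightarrow> c \<le> slope_along q y x"
  unfolding slope_along_def by (intro cINF_greatest) auto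

text \<open>The subtracted part is linear in the parameter, so the terms for \<open>t\<close> at
  \<open>x\<close> and \<open>s\<close> at \<open>x'\<close> together dominate the term for
  \<open>t + s\<close> at \<open>x + x'\<close>. Likewise \<open>t\<close> at \<open>x\<close>
  corresponds to \<open>r * t\<close> at \<open>r *\<^sub>R x\<close>.\<close>

lemma sublinear_slope_along:
  assumes q: "sublinear q"
  shows "sublinear (slope_along q y)"
  unfolding sublinear_def
proof (intro conjI allI impI)
  fix x x'
  have *: "slope_along q y (x + x') \<le> (q (x + t *\<^sub>R y) - t * q y) + (q (x' + s *\<^sub>R y) - s * q y)"
    if "0 \<le> t" "0 \<le> s" for t s
  proof -
    have "slope_along q y (x + x') \<le> q (x + x' + (t + s) *\<^sub>R y) - (t + s) * q y"
      using q that by (intro slope_along_le) auto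
    also have "\<dots> = q ((x + t *\<^sub>R y) + (x' + s *\<^sub>R y)) - (t + s) * q y"
      by (simp add: algebra_simps)
    also have "\<dots> \<le> (q (x + t *\<^sub>R y) - t * q y) + (q (x' + s *\<^sub>R y) - s * q y)"
      using sublinear_add[OF q, of "x + t *\<^sub>R y" "x' + s *\<^sub>R y"] by (simp add: algebra_simps)
    finally show ?thesis .
  qed
  \<comment> \<open>The two infima are taken one at a time: over \<open>s\<close> here, over
    \<open>t\<close> next.\<close>
  have "slope_along q y (x + x') - (q (x + t *\<^sub>R y) - t * q y) \<le> slope_along q y x'"
    if "0 \<le> t" for t
    using *[OF that] by (intro slope_along_greatest) (simp add: algebra_simps)
  then have "slope_along q y (x + x') - slope_along q y x' \<le> slope_along q y x"
    by (intro slope_along_greatest) (simp add: algebra_simps)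
  then show "slope_along q y (x + x') \<le> slope_along q y x + slope_along q y x'"
    by simp
next
  fix r :: real and x
  assume r: "0 \<le> r"
  show "slope_along q y (r *\<^sub>R x) \<le> r * slope_along q y x"
  proof (cases "r = 0")
    case True
    then show ?thesis
      using slope_along_le[OF q, of 0 y 0] sublinear_zero[OF q] by simp
  next
    case False
    have "slope_along q y (r *\<^sub>R x) / r \<le> q (x + t *\<^sub>R y) - t * q y" if "0 \<le> t" for t
    proof -
      have "slope_along q y (r *\<^sub>R x) \<le> q (r *\<^sub>R x + (r * t) *\<^sub>R y) - (r * t) * q y"
        using q r that by (intro slope_along_le) auto
      also have "\<dots> = r * (q (x + t *\<^sub>R y) - t * q y)"
        using sublinear_scaleR[OF q r, of "x + t *\<^sub>R y"] by (simp add: algebra_simps)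
      finally show ?thesis
        using False r by (simp add: field_simps)
    qed
    then have "slope_along q y (r *\<^sub>R x) / r \<le> slope_along q y x"
      by (rule slope_along_greatest)
    then show ?thesis
      using False r by (simp add: field_simps)
  qed
qed

lemma slope_along_le_self: "sublinear q \<Longrightarrow> slope_along q y \<le> q"
  using slope_along_le[of q 0 y] by (auto simp: le_fun_def)

section \<open>Minimal sublinear functionals and the dominated functional\<close>

text \<open>The common bound \<open>p\<close> keeps the infimum finite, since - p (- x) \<le> - q (-
  x) \<le> q x. Comparability gives subadditivity: when different members nearly attain the infimum
  at \<open>x\<close> and at \<open>y\<close>, the smaller of the two serves for both.\<close>

lemma sublinear_INF_chain:
  assumes "C \<noteq> {}" and C: "\<And>q. q \<in> C \<Longrightarrow> sublinear q \<and> q \<le> p"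
    and chain: "\<And>q q'. q \<in> C \<Longrightarrow> q' \<in> C \<Longrightarrow> q \<le> q' \<or> q' \<le> q"
  defines "u \<equiv> \<lambda>x. INF q\<in>C. q x"
  shows "sublinear u" "\<And>q. q \<in> C \<Longrightarrow> u \<le> q"
proof -
  have "bdd_below ((\<lambda>q. q x) ` C)" for x
  proof (rule bdd_belowI2)
    fix q assume "q \<in> C"
    then show "- p (- x) \<le> q x"
      using C[of q] sublinear_minus[of q x] by (auto simp: le_fun_def intro: order_trans[rotated])
  qed
  then have lower: "u x \<le> q x" if "q \<in> C" for q x
    unfolding u_def using that by (rule cINF_lower)
  then show "\<And>q. q \<in> C \<Longrightarrow> u \<le> q"
    by (simp add: le_fun_def)
  have greatest: "c \<le> u x" if "\<And>q. q \<in> C \<Longrightarrow> c \<le> q x" for c x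
    unfolding u_def using assms(1) that by (rule cINF_greatest)
  show "sublinear u"
    unfolding sublinear_def
  proof (intro conjI allI impI)
    fix x y
    have *: "u (x + y) \<le> q x + q' y" if qq': "q \<in> C" "q' \<in> C" for q q'
    proof -
      obtain m where m: "m \<in> C" "m \<le> q" "m \<le> q'"
        using chain[OF qq'] qq' by blast
      have "u (x + y) \<le> m (x + y)"
        using m(1) by (rule lower)
      also have "\<dots> \<le> m x + m y"
        using C[OF m(1)] by (simp add: sublinear_add)
      also have "\<dots> \<le> q x + q' y"
        using m by (intro add_mono) (simp_all add: le_fun_def)
      finally show ?thesis .
    qed
    have "u (x + y) - q x \<le> u y" if "q \<in> C" for q
      using *[OF that] by (intro greatest) (simp add: algebra_simps)
    then have "u (x + y) - u y \<le> u x"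
      by (intro greatest) (simp add: algebra_simps)
    then show "u (x + y) \<le> u x + u y"
      by simp
  next
    fix r :: real and x
    assume r: "0 \<le> r"
    have *: "u (r *\<^sub>R x) \<le> r * q x" if "q \<in> C" for q
      using lower[OF that, of "r *\<^sub>R x"] C[OF that] sublinear_scaleR[of q r x] r by simp
    show "u (r *\<^sub>R x) \<le> r * u x"
    proof (cases "r = 0")
      case True
      then show ?thesis
        using * assms(1) by auto
    next
      case False
      then have "u (r *\<^sub>R x) / r \<le> u x"
        using * r by (intro greatest) (simp add: field_simps)
      then show ?thesis
        using False r by (simp add: field_simps)
    qed
  qed
qed

text \<open>Zorn's lemma for the reversed pointwise order: chains are bounded by their infima, and a
  maximal element is a minimal functional.\<close>

lemma minimal_sublinear_exists:
  fixes p :: "'a::real_vector \<Rightarrow> real"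
  assumes "sublinear p"
  obtains q where "sublinear q" "q \<le> p" "\<And>q'. sublinear q' \<Longrightarrow> q' \<le> q \<Longrightarrow> q' = q"
proof -
  define S where "S = {q. sublinear q \<and> q \<le> p}"
  have "\<exists>m\<in>S. \<forall>q\<in>S. m \<ge> q \<longrightarrow> q = m"
  proof (rule predicate_Zorn)
    show "partial_order_on S (relation_of (\<ge>) S)"
      by (rule partial_order_on_relation_ofI) auto
    fix C assume C: "C \<in> Chains (relation_of (\<ge>) S)"
    have CS: "C \<subseteq> S"
      using C by (auto simp: Chains_def relation_of_def)
    show "\<exists>u\<in>S. \<forall>q\<in>C. q \<ge> u"
    proof (cases "C = {}")
      \<comment> \<open>An infimum over the empty family carries no information, so \<open>p\<close>
        itself bounds the empty chain.\<close>
      case True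
      then show ?thesis
        using assms by (auto simp: S_def)
    next
      case False
      define u where "u = (\<lambda>x. INF q\<in>C. q x)"
      have 1: "sublinear q \<and> q \<le> p" if "q \<in> C" for q
        using that CS by (auto simp: S_def)
      have 2: "q \<le> q' \<or> q' \<le> q" if "q \<in> C" "q' \<in> C" for q q'
        using that C by (auto simp: Chains_def relation_of_def)
      have u: "sublinear u" "\<And>q. q \<in> C \<Longrightarrow> u \<le> q"
        unfolding u_def by (rule sublinear_INF_chain[OF False 1 2]; assumption)+
      moreover have "u \<le> p"
        using False u(2) 1 by (meson all_not_in_conv order_trans)
      ultimately show ?thesis
        by (auto simp: S_def)
    qed
  qed
  then obtain m where "m \<in> S" "\<And>q. q \<in> S \<Longrightarrow> q \<le> m \<Longrightarrow> q = m"
    by auto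
  then show thesis
    by (intro that[of m]) (auto simp: S_def)
qed

text \<open>Minimality forces \<open>slope_along q y = q\<close>. The parameter t = 1 then gives q x
  \<le> q (x + y) - q y, the reverse of subadditivity; additivity extends the scaling rule to
  negative scalars.\<close>

lemma minimal_sublinear_linear:
  fixes q :: "'a::real_vector \<Rightarrow> real"
  assumes q: "sublinear q" and min: "\<And>q'. sublinear q' \<Longrightarrow> q' \<le> q \<Longrightarrow> q' = q"
  shows "linear q"
proof -
  have add: "q (x + y) = q x + q y" for x y
  proof -
    have "slope_along q y = q"
      using q by (intro min sublinear_slope_along slope_along_le_self)
    then have "q x \<le> q (x + y) - q y"
      using slope_along_le[OF q, of 1 y x] by simp
    then show ?thesis
      using sublinear_add[OF q, of x y] by simp
  qed
  have minus: "q (- x) = - q x" for x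
    using add[of x "- x"] sublinear_zero[OF q] by simp
  have "q (r *\<^sub>R x) = r * q x" for r x
  proof (cases "0 \<le> r")
    case False
    then show ?thesis
      using sublinear_scaleR[OF q, of "- r" "x"] minus[of "r *\<^sub>R x"] by simp
  qed (simp add: sublinear_scaleR[OF q])
  with add show ?thesis
    by (intro linearI) simp_all
qed

text \<open>Minimizing below \<open>slope_along p x0\<close> instead of \<open>p\<close> pins the
  value at \<open>x0\<close>: this slope is at most \<open>- p x0\<close> at \<open>- x0\<close>, so
  linearity gives p x0 \<le> q x0.\<close>

theorem hahn_banach_sublinear:
  fixes p :: "'a::real_vector \<Rightarrow> real"
  assumes p: "sublinear p"
  obtains q where "linear q" "q \<le> p" "q x0 = p x0"
proof -
  obtain q where q: "sublinear q" "q \<le> slope_along p x0"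
    "\<And>q'. sublinear q' \<Longrightarrow> q' \<le> q \<Longrightarrow> q' = q"
    using minimal_sublinear_exists[OF sublinear_slope_along[OF p]] by blast
  have lin: "linear q"
    using q(1,3) by (rule minimal_sublinear_linear)
  have le: "q \<le> p"
    using q(2) slope_along_le_self[OF p] by (rule order_trans)
  have "q (- x0) \<le> slope_along p x0 (- x0)"
    using q(2) by (simp add: le_fun_def)
  also have "\<dots> \<le> - p x0"
    using slope_along_le[OF p, of 1 x0 "- x0"] sublinear_zero[OF p] by simp
  finally have "p x0 \<le> q x0"
    using lin by (simp add: linear_neg)
  with le have "q x0 = p x0"
    by (simp add: le_fun_def antisym)
  with lin le show thesis
    by (rule that)
qed

section \<open>Separation from a closed subspace\<close>

text \<open>Nearly closest points of \<open>M\<close> to \<open>x\<close> and \<open>y\<close> add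
  up to a point of \<open>M\<close> near \<open>x + y\<close>, and they scale with \<open>x\<close>.
  This makes the distance usable as the dominating functional.\<close>

lemma sublinear_infdist_subspace:
  fixes M :: "'a::real_normed_vector set"
  assumes M: "subspace M"
  shows "sublinear (\<lambda>x. infdist x M)"
proof -
  have ne: "M \<noteq> {}"
    using subspace_0[OF M] by auto
  have near: "\<exists>m\<in>M. dist x m < infdist x M + e" if "0 < e" for x e
    using that ne cInf_lessD[of "dist x ` M" "infdist x M + e"]
    by (auto simp: infdist_notempty)
  show ?thesis
    unfolding sublinear_def
  proof (intro conjI allI impI)
    fix x y
    show "infdist (x + y) M \<le> infdist x M + infdist y M"
    proof (rule field_le_epsilon)
      fix e :: real assume "0 < e"
      then obtain m n where mn: "m \<in> M" "n \<in> M"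
        "dist x m < infdist x M + e / 2" "dist y n < infdist y M + e / 2"
        using near[of "e / 2"] by (metis half_gt_zero)
      have "infdist (x + y) M \<le> dist (x + y) (m + n)"
        using M mn by (intro infdist_le subspace_add)
      also have "\<dots> \<le> dist x m + dist y n"
        by (rule dist_triangle_add)
      finally show "infdist (x + y) M \<le> infdist x M + infdist y M + e"
        using mn by simp
    qed
  next
    fix r :: real and x
    assume r: "0 \<le> r"
    have *: "infdist (r *\<^sub>R x) M \<le> r * dist x m" if "m \<in> M" for m
      using infdist_le[OF subspace_scale[OF M that, of r], of "r *\<^sub>R x"] r
      by (simp add: dist_norm flip: scaleR_diff_right)
    show "infdist (r *\<^sub>R x) M \<le> r * infdist x M"
    proof (cases "r = 0")
      case True
      then show ?thesis
        using * ne by auto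
    next
      case False
      then have "infdist (r *\<^sub>R x) M / r \<le> infdist x M"
        using * r ne unfolding infdist_notempty[OF ne, of x]
        by (intro cINF_greatest) (simp_all add: field_simps)
      then show ?thesis
        using False r by (simp add: field_simps)
    qed
  qed
qed

text \<open>Domination by the distance does everything once it is applied to both \<open>x\<close>
  and \<open>- x\<close>: the distance vanishes on \<open>M\<close>, is at most the norm because 0
  lies in \<open>M\<close>, and is positive at \<open>x0\<close>, where \<open>q\<close> attains
  it.\<close>

lemma separating_functional_real:
  fixes M :: "'a::real_normed_vector set"
  assumes M: "subspace M" and "x0 \<notin> closure M"
  obtains q :: "'a \<Rightarrow> real" where "bounded_linear q" "\<And>x. x \<in> M \<Longrightarrow> q x = 0" "q x0 \<noteq> 0"
proof -
  have ne: "M \<noteq> {}"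
    using subspace_0[OF M] by auto
  obtain q where q: "linear q" "q \<le> (\<lambda>x. infdist x M)" "q x0 = infdist x0 M"
    using hahn_banach_sublinear[OF sublinear_infdist_subspace[OF M]] by blast
  have le: "q x \<le> infdist x M" for x
    using q(2) by (simp add: le_fun_def)
  have neg: "q (- x) = - q x" for x
    using q(1) by (rule linear_neg)
  have "infdist x M \<le> norm x" for x
    using infdist_le[OF subspace_0[OF M], of x] by simp
  then have "\<bar>q x\<bar> \<le> norm x" for x
    using le[of x] le[of "- x"] neg[of x] by (smt (verit) norm_minus_cancel)
  then have "bounded_linear q"
    using q(1) by (intro linear_conv_bounded_linear[THEN iffD1] bounded_linear_intro[of q 1])
      (simp_all add: linear_add linear_scale)
  moreover have "q x = 0" if "x \<in> M" for x
    using le[of x] le[of "- x"] neg[of x] that subspace_neg[OF M that] by simp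
  moreover have "q x0 \<noteq> 0"
    using assms(2) ne q(3) by (simp add: in_closure_iff_infdist_zero)
  ultimately show thesis
    by (rule that)
qed

section \<open>From real to complex functionals\<close>

lemma bounded_linear_scaleC: "bounded_linear (\<lambda>x :: 'a::complex_banach_algebra. c *\<^sub>C x)"
proof (rule bounded_linear_intro)
  fix r :: real and x :: 'a
  show "c *\<^sub>C r *\<^sub>R x = r *\<^sub>R (c *\<^sub>C x)"
    by (simp add: scaleC_scaleC mult.commute flip: scaleC_of_real)
  show "norm (c *\<^sub>C x) \<le> norm x * cmod c"
    by (simp add: norm_scaleC mult.commute)
qed (rule scaleC_add_right)

lemma scaleC_Re_Im: "c *\<^sub>C x = Re c *\<^sub>R x + Im c *\<^sub>R (\<i> *\<^sub>C x)"
  for x :: "'a::complex_banach_algebra"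
proof -
  have "c = of_real (Re c) + of_real (Im c) * \<i>"
    by (simp add: complex_eq_iff)
  then have "c *\<^sub>C x = (of_real (Re c) + of_real (Im c) * \<i>) *\<^sub>C x"
    by simp
  then show ?thesis
    by (simp only: scaleC_add_left scaleC_of_real flip: scaleC_scaleC)
qed

lemma separating_functional:
  fixes M :: "'a::complex_banach_algebra set"
  assumes M: "complex_vector.subspace M" and "closure M \<noteq> UNIV"
  obtains f x0 where "f \<in> dual" "\<And>x. x \<in> M \<Longrightarrow> blinfun_apply f x = 0" "blinfun_apply f x0 \<noteq> 0"
proof -
  have real_M: "subspace M"
    using M unfolding subspace_def complex_vector.subspace_def by (metis scaleC_of_real)
  obtain x0 where "x0 \<notin> closure M"
    using assms(2) by auto
  then obtain q :: "'a \<Rightarrow> real" where q: "bounded_linear q" "\<And>x. x \<in> M \<Longrightarrow> q x = 0" "q x0 \<noteq> 0"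
    using separating_functional_real[OF real_M] by blast
  interpret q: bounded_linear q by (rule q(1))
  \<comment> \<open>The complex-linear functional whose real part is \<open>q\<close>.\<close>
  define f where "f = (\<lambda>x. of_real (q x) - \<i> * of_real (q (\<i> *\<^sub>C x)))"
  have "bounded_linear f"
    unfolding f_def
    by (intro bounded_linear_sub bounded_linear_const_mult
        bounded_linear_compose[OF bounded_linear_of_real]
        bounded_linear_compose[OF q(1)] q(1) bounded_linear_scaleC)
  then have apply_f: "blinfun_apply (Blinfun f) = f"
    by (rule bounded_linear_Blinfun_apply)
  have ii: "\<i> *\<^sub>C \<i> *\<^sub>C x = - x" for x :: 'a
    using scaleC_of_real[of "-1" x] by (simp add: scaleC_scaleC)
  \<comment> \<open>Splitting \<open>c\<close> into real and imaginary parts reduces this to real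
    linearity and i * i = -1.\<close>
  have "f (c *\<^sub>C x) = c * f x" for c x
    unfolding f_def scaleC_Re_Im[of c x]
    by (simp add: scaleC_add_right q.add q.diff q.scaleR ii linear_neg[OF q.linear] complex_eq_iff algebra_simps
        linear_scale[OF bounded_linear.linear[OF bounded_linear_scaleC]])
  then have "Blinfun f \<in> dual"
    by (simp add: dual_def apply_f)
  \<comment> \<open>Since \<open>M\<close> is a complex subspace, \<open>\<i> *\<^sub>C x\<close>
    lies in \<open>M\<close> too, so both parts vanish.\<close>
  moreover have "f x = 0" if "x \<in> M" for x
    using that q(2) complex_vector.subspace_scale[OF M that] by (simp add: f_def)
  moreover have "Re (f x0) = q x0"
    by (simp add: f_def)
  then have "f x0 \<noteq> 0"
    using q(3) by auto
  ultimately show thesis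
    by (intro that[of "Blinfun f" x0]) (simp_all add: apply_f)
qed


section \<open>Pulling back derivations along homomorphisms\<close>

definition algebra_hom ::
    "('a::complex_banach_algebra \<Rightarrow>\<^sub>L 'b::complex_banach_algebra) \<Rightarrow> bool" where
  "algebra_hom h \<longleftrightarrow> (\<forall>c x. h (c *\<^sub>C x) = c *\<^sub>C h x) \<and> (\<forall>x y. h (x * y) = h x * h y)"

text \<open>The map \<open>D\<close> conjugated by \<open>h\<close> and its adjoint. Projections
  lift derivations from a factor to the product; embeddings restrict derivations of the product to a
  factor.\<close>

definition pullback ::
    "('a::complex_banach_algebra \<Rightarrow>\<^sub>L 'b::complex_banach_algebra) \<Rightarrow>
      ('b \<Rightarrow> ('b \<Rightarrow>\<^sub>L complex)) \<Rightarrow> 'a \<Rightarrow> ('a \<Rightarrow>\<^sub>L complex)" where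
  "pullback h D a = D (h a) o\<^sub>L h"

lemma pullback_apply [simp]: "pullback h D a x = D (h a) (h x)"
  by (simp add: pullback_def)

lemma dual_compose_hom: "f \<in> dual \<Longrightarrow> algebra_hom h \<Longrightarrow> f o\<^sub>L h \<in> dual"
  by (simp add: dual_def algebra_hom_def)

text \<open>The adjoint of a homomorphism respects the module actions: \<open>(f \<triangleleft> h
  a) o\<^sub>L h = (f o\<^sub>L h) \<triangleleft> a\<close>, and similarly on the left.\<close>

lemma derivation_pullback:
  assumes "derivation D" "algebra_hom h"
  shows "derivation (pullback h D)"
  using assms dual_compose_hom unfolding derivation_def pullback_def
  by (auto simp: algebra_hom_def blinfun.bilinear_simps blinfun_eqI)

lemma cyclic_pullback: "cyclic D \<Longrightarrow> cyclic (pullback h D)"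
  by (simp add: cyclic_def)

lemma continuous_on_pullback:
  assumes "continuous_on UNIV D"
  shows "continuous_on UNIV (pullback h D)"
proof -
  have "continuous_on UNIV (\<lambda>a. D (h a))"
    by (rule continuous_on_compose2[OF assms
          bounded_linear.continuous_on[OF blinfun.bounded_linear_right continuous_on_id]]) simp
  then show ?thesis
    unfolding pullback_def
    by (rule bounded_bilinear.continuous_on[OF bounded_bilinear_blinfun_compose _ continuous_on_const])
qed

lemma pullback_inner_derivation:
  "algebra_hom h \<Longrightarrow> pullback h (inner_derivation f) = inner_derivation (f o\<^sub>L h)"
  by (auto simp: algebra_hom_def inner_derivation_def blinfun.bilinear_simps
      intro!: ext blinfun_eqI)

lemma is_inner_pullback: "is_inner D \<Longrightarrow> algebra_hom h \<Longrightarrow> is_inner (pullback h D)"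
  unfolding is_inner_def using pullback_inner_derivation dual_compose_hom by blast

section \<open>Closure of inner and approximately inner maps under sums and pullbacks\<close>

lemma inner_derivation_add:
  "inner_derivation (f + g) a = inner_derivation f a + inner_derivation g a"
  by (rule blinfun_eqI) (simp add: inner_derivation_def blinfun.bilinear_simps)

lemma dual_add: "f \<in> dual \<Longrightarrow> g \<in> dual \<Longrightarrow> f + g \<in> dual"
  by (simp add: dual_def blinfun.bilinear_simps distrib_left)

lemma is_inner_add: "is_inner D \<Longrightarrow> is_inner E \<Longrightarrow> is_inner (\<lambda>a. D a + E a)"
  unfolding is_inner_def by (metis (no_types, lifting) ext dual_add inner_derivation_add)

text \<open>Allows approximating functionals indexed by a filter on any type; the image filter under
  \<phi> is the one that the definition asks for.\<close>

lemma approximately_innerI: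
  assumes "F \<noteq> bot" "\<forall>\<^sub>F i in F. \<phi> i \<in> dual"
    and "\<And>a. ((\<lambda>i. norm (D a - inner_derivation (\<phi> i) a)) \<longlongrightarrow> 0) F"
  shows "approximately_inner D"
  unfolding approximately_inner_def
proof (intro exI[of _ "filtermap \<phi> F"] conjI allI)
  show "filtermap \<phi> F \<noteq> bot"
    using assms(1) by (simp only: filtermap_bot_iff not_False_eq_True)
  show "\<forall>\<^sub>F f in filtermap \<phi> F. f \<in> dual"
    using assms(2) by (simp only: eventually_filtermap)
  show "((\<lambda>f. norm (D a - inner_derivation f a)) \<longlongrightarrow> 0) (filtermap \<phi> F)" for a
    using assms(3) by (simp only: filterlim_filtermap)
qed

text \<open>Composing the approximating functionals with \<open>h\<close> multiplies the error at
  \<open>a\<close> by at most \<open>norm h\<close>, relative to the error for \<open>D\<close> at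
  \<open>h a\<close>.\<close>

lemma approximately_inner_pullback:
  assumes "approximately_inner D" and h: "algebra_hom h"
  shows "approximately_inner (pullback h D)"
proof -
  obtain F where F: "F \<noteq> bot" "\<forall>\<^sub>F f in F. f \<in> dual"
    "\<And>a. ((\<lambda>f. norm (D a - inner_derivation f a)) \<longlongrightarrow> 0) F"
    using assms(1) unfolding approximately_inner_def by blast
  show ?thesis
  proof (rule approximately_innerI)
    show "F \<noteq> bot" by (rule F(1))
    show "\<forall>\<^sub>F f in F. f o\<^sub>L h \<in> dual"
      using F(2) by eventually_elim (simp add: dual_compose_hom h)
    fix a
    have le: "norm (pullback h D a - inner_derivation (f o\<^sub>L h) a)
        \<le> norm (D (h a) - inner_derivation f (h a)) * norm h" for f
    proof -
      have "pullback h D a - inner_derivation (f o\<^sub>L h) a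
          = (D (h a) - inner_derivation f (h a)) o\<^sub>L h"
        unfolding pullback_inner_derivation[OF h, symmetric]
        by (rule blinfun_eqI) (simp add: blinfun.bilinear_simps)
      then show ?thesis
        by (simp add: norm_blinfun_compose)
    qed
    then show "((\<lambda>f. norm (pullback h D a - inner_derivation (f o\<^sub>L h) a)) \<longlongrightarrow> 0) F"
      by (intro Lim_null_comparison[OF always_eventually 
            tendsto_mult_left_zero[OF F(3)[of "h a"], of "norm h"]] allI) (simp add: le)
  qed
qed

text \<open>The two approximations run along unrelated filters, so the sums of functionals are
  indexed by the product filter.\<close>

lemma approximately_inner_add:
  assumes "approximately_inner D" "approximately_inner E"
  shows "approximately_inner (\<lambda>a. D a + E a)"
proof -
  obtain F where F: "F \<noteq> bot" "\<forall>\<^sub>F f in F. f \<in> dual"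
    "\<And>a. ((\<lambda>f. norm (D a - inner_derivation f a)) \<longlongrightarrow> 0) F"
    using assms(1) unfolding approximately_inner_def by blast
  obtain G where G: "G \<noteq> bot" "\<forall>\<^sub>F g in G. g \<in> dual"
    "\<And>a. ((\<lambda>g. norm (E a - inner_derivation g a)) \<longlongrightarrow> 0) G"
    using assms(2) unfolding approximately_inner_def by blast
  show ?thesis
  proof (rule approximately_innerI)
    show "F \<times>\<^sub>F G \<noteq> bot"
      using F(1) G(1) by (simp add: prod_filter_eq_bot)
    show "\<forall>\<^sub>F i in F \<times>\<^sub>F G. fst i + snd i \<in> dual"
      using eventually_prodI[OF F(2) G(2)] by eventually_elim (simp add: dual_add)
    fix a
    have le: "norm (D a + E a - inner_derivation (f + g) a)
        \<le> norm (D a - inner_derivation f a) + norm (E a - inner_derivation g a)" for f g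
      by (simp add: inner_derivation_add norm_diff_triangle_ineq)
    have "((\<lambda>i. norm (D a - inner_derivation (fst i) a) + norm (E a - inner_derivation (snd i) a))
        \<longlongrightarrow> 0) (F \<times>\<^sub>F G)"
      using tendsto_add[OF filterlim_compose[OF F(3) filterlim_fst]
          filterlim_compose[OF G(3) filterlim_snd]] by simp
    then show "((\<lambda>i. norm (D a + E a - inner_derivation (fst i + snd i) a)) \<longlongrightarrow> 0) (F \<times>\<^sub>F G)"
      by (rule Lim_null_comparison[OF always_eventually, rotated]) (simp add: le)
  qed
qed

section \<open>Retracts\<close>

lemma pullback_section:
  assumes "\<And>x. blinfun_apply p (blinfun_apply i x) = x"
  shows "pullback i (pullback p D) = D"
  by (auto simp: assms intro!: ext blinfun_eqI)

text \<open>A derivation is lifted along \<open>p\<close>, is inner there, and pulling back along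
  \<open>i\<close> recovers the original one.\<close>

lemma cyclic_amenable_retract:
  fixes i :: "'a::complex_banach_algebra \<Rightarrow>\<^sub>L 'b::complex_banach_algebra"
  assumes "cyclic_amenable TYPE('b)" "algebra_hom i" "algebra_hom p" "\<And>x. p (i x) = x"
  shows "cyclic_amenable TYPE('a)"
  unfolding cyclic_amenable_def
proof (intro allI impI)
  fix D :: "'a \<Rightarrow> ('a \<Rightarrow>\<^sub>L complex)"
  assume "derivation D \<and> cyclic D \<and> continuous_on UNIV D"
  then have "is_inner (pullback p D)"
    using assms(1,3) derivation_pullback cyclic_pullback continuous_on_pullback
    unfolding cyclic_amenable_def by blast
  from is_inner_pullback[OF this assms(2)] show "is_inner D"
    by (simp add: pullback_section[OF assms(4)])
qed

lemma approximately_cyclic_amenable_retract: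
  fixes i :: "'a::complex_banach_algebra \<Rightarrow>\<^sub>L 'b::complex_banach_algebra"
  assumes "approximately_cyclic_amenable TYPE('b)" "algebra_hom i" "algebra_hom p" "\<And>x. p (i x) = x"
  shows "approximately_cyclic_amenable TYPE('a)"
  unfolding approximately_cyclic_amenable_def
proof (intro allI impI)
  fix D :: "'a \<Rightarrow> ('a \<Rightarrow>\<^sub>L complex)"
  assume "derivation D \<and> cyclic D \<and> continuous_on UNIV D"
  then have "approximately_inner (pullback p D)"
    using assms(1,3) derivation_pullback cyclic_pullback continuous_on_pullback
    unfolding approximately_cyclic_amenable_def by blast
  from approximately_inner_pullback[OF this assms(2)] show "approximately_inner D"
    by (simp add: pullback_section[OF assms(4)])
qed

text \<open>By the Leibniz rule \<open>D (i (a * c)) y\<close> is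
  \<open>D (i a) (i c * y) + D (i c) (y * i a)\<close>, which is zero. The zero set in
  \<open>a\<close> is a closed subspace containing all products, hence everything.\<close>

lemma derivation_annihilator_eq_0:
  fixes i :: "'a::complex_banach_algebra \<Rightarrow>\<^sub>L 'b::complex_banach_algebra"
  assumes D: "derivation D" "continuous_on UNIV D" and i: "algebra_hom i"
    and dense: "square_dense TYPE('a)"
    and ann: "\<And>a. i a * y = 0" "\<And>a. y * i a = 0"
  shows "D (i a) y = 0"
proof -
  define Z where "Z = {a. D (i a) y = 0}"
  have "closed Z"
    unfolding Z_def
    by (intro closed_Collect_eq continuous_intros continuous_on_compose2[OF D(2)]) auto
  moreover have "complex_vector.subspace Z"
    using D(1) i unfolding Z_def complex_vector.subspace_def derivation_def algebra_hom_def
    by (simp add: blinfun.bilinear_simps) (metis add_cancel_right_left blinfun.zero_left)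
  moreover have "a * c \<in> Z" for a c
    using D(1) i ann by (simp add: Z_def derivation_def algebra_hom_def blinfun.bilinear_simps)
  ultimately have "closure (square :: 'a set) \<subseteq> Z"
    unfolding square_def
    by (intro closure_minimal complex_vector.span_minimal) auto
  then show ?thesis
    using dense by (auto simp: square_dense_def Z_def)
qed


section \<open>The direct product\<close>

definition dp_proj1 :: "('a::complex_banach_algebra \<oplus> 'b::complex_banach_algebra) \<Rightarrow>\<^sub>L 'a" where
  "dp_proj1 = Blinfun dp_fst"

definition dp_proj2 :: "('a::complex_banach_algebra \<oplus> 'b::complex_banach_algebra) \<Rightarrow>\<^sub>L 'b" where
  "dp_proj2 = Blinfun dp_snd"

definition dp_in1 :: "'a \<Rightarrow>\<^sub>L ('a::complex_banach_algebra \<oplus> 'b::complex_banach_algebra)" where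
  "dp_in1 = Blinfun (\<lambda>a. DP a 0)"

definition dp_in2 :: "'b \<Rightarrow>\<^sub>L ('a::complex_banach_algebra \<oplus> 'b::complex_banach_algebra)" where
  "dp_in2 = Blinfun (\<lambda>b. DP 0 b)"

lemma dp_blinfun_apply [simp]:
  fixes z :: "'a::complex_banach_algebra \<oplus> 'b::complex_banach_algebra"
  shows "blinfun_apply dp_proj1 z = dp_fst z" "blinfun_apply dp_proj2 z = dp_snd z"
    "blinfun_apply dp_in1 a = (DP a 0 :: 'a \<oplus> 'b)" "blinfun_apply dp_in2 b = (DP 0 b :: 'a \<oplus> 'b)"
proof -
  have "bounded_linear (dp_fst :: 'a \<oplus> 'b \<Rightarrow> 'a)" "bounded_linear (dp_snd :: 'a \<oplus> 'b \<Rightarrow> 'b)"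
    "bounded_linear (\<lambda>a. DP a 0 :: 'a \<oplus> 'b)" "bounded_linear (\<lambda>b. DP 0 b :: 'a \<oplus> 'b)"
    by (rule bounded_linear_intro[of _ 1]; simp add: dp_alg_defs norm_direct_product_def)+
  then show "blinfun_apply dp_proj1 z = dp_fst z" "blinfun_apply dp_proj2 z = dp_snd z"
    "blinfun_apply dp_in1 a = (DP a 0 :: 'a \<oplus> 'b)" "blinfun_apply dp_in2 b = (DP 0 b :: 'a \<oplus> 'b)"
    unfolding dp_proj1_def dp_proj2_def dp_in1_def dp_in2_def
    by (simp_all only: bounded_linear_Blinfun_apply)
qed

lemma algebra_hom_dp [simp]:
  "algebra_hom dp_proj1" "algebra_hom dp_proj2" "algebra_hom dp_in1" "algebra_hom dp_in2"
  by (simp_all add: algebra_hom_def dp_alg_defs scaleC_direct_product_def)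

lemma derivation_dp_decompose:
  fixes D :: "('a::complex_banach_algebra \<oplus> 'b::complex_banach_algebra) \<Rightarrow> (('a \<oplus> 'b) \<Rightarrow>\<^sub>L complex)"
  assumes D: "derivation D" "cyclic D" "continuous_on UNIV D"
    and dense: "square_dense TYPE('a) \<or> square_dense TYPE('b)"
  shows "D = (\<lambda>z. pullback dp_proj1 (pullback dp_in1 D) z + pullback dp_proj2 (pullback dp_in2 D) z)"
proof -
  have flip: "D z w = - D w z" for z w
    using D(2) by (simp add: cyclic_def eq_neg_iff_add_eq_0)
  have cross: "D (DP a 0) (DP 0 b) = 0" for a b
    using dense
  proof
    assume "square_dense TYPE('a)"
    from derivation_annihilator_eq_0[OF D(1,3) algebra_hom_dp(3) this, of "DP 0 b" a]
    show ?thesis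
      by (simp add: dp_alg_defs)
  next
    \<comment> \<open>Density in the second factor kills the mixed term with its arguments in the
      opposite order; cyclicity turns it around.\<close>
    assume "square_dense TYPE('b)"
    from derivation_annihilator_eq_0[OF D(1,3) algebra_hom_dp(4) this, of "DP a 0" b]
    have "D (DP 0 b) (DP a 0) = 0"
      by (simp add: dp_alg_defs)
    then show ?thesis
      using flip[of "DP a 0" "DP 0 b"] by simp
  qed
  have cross': "D (DP 0 b) (DP a 0) = 0" for a b
    using flip[of "DP 0 b" "DP a 0"] cross by simp
  have split: "z = DP (dp_fst z) 0 + DP 0 (dp_snd z)" for z :: "'a \<oplus> 'b"
    by (simp add: dp_alg_defs)
  have add: "D (z + w) = D z + D w" for z w
    using D(1) by (simp add: derivation_def)
  show ?thesis
  proof (intro ext blinfun_eqI)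
    fix z w
    \<comment> \<open>Expanding both arguments by coordinates gives four terms, of which
      \<open>cross\<close> and \<open>cross'\<close> remove the mixed ones.\<close>
    have "D z w = D (DP (dp_fst z) 0 + DP 0 (dp_snd z)) (DP (dp_fst w) 0 + DP 0 (dp_snd w))"
      by (simp flip: split)
    then show "D z w = (pullback dp_proj1 (pullback dp_in1 D) z
        + pullback dp_proj2 (pullback dp_in2 D) z) w"
      by (simp add: add blinfun.bilinear_simps cross cross')
  qed
qed

lemma cyclic_amenable_dp:
  assumes "cyclic_amenable TYPE('a::complex_banach_algebra)"
    and "cyclic_amenable TYPE('b::complex_banach_algebra)"
    and "square_dense TYPE('a) \<or> square_dense TYPE('b)"
  shows "cyclic_amenable TYPE('a \<oplus> 'b)"
  unfolding cyclic_amenable_def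
proof (intro allI impI)
  fix D :: "('a \<oplus> 'b) \<Rightarrow> (('a \<oplus> 'b) \<Rightarrow>\<^sub>L complex)"
  assume D: "derivation D \<and> cyclic D \<and> continuous_on UNIV D"
  have "is_inner (pullback dp_in1 D)" "is_inner (pullback dp_in2 D)"
    using assms(1,2) D derivation_pullback cyclic_pullback continuous_on_pullback algebra_hom_dp
    unfolding cyclic_amenable_def by blast+
  then show "is_inner D"
    using D assms(3)
    by (subst derivation_dp_decompose) (auto intro!: is_inner_add is_inner_pullback)
qed

lemma approximately_cyclic_amenable_dp:
  assumes "approximately_cyclic_amenable TYPE('a::complex_banach_algebra)"
    and "approximately_cyclic_amenable TYPE('b::complex_banach_algebra)"
    and "square_dense TYPE('a) \<or> square_dense TYPE('b)"
  shows "approximately_cyclic_amenable TYPE('a \<oplus> 'b)"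
  unfolding approximately_cyclic_amenable_def
proof (intro allI impI)
  fix D :: "('a \<oplus> 'b) \<Rightarrow> (('a \<oplus> 'b) \<Rightarrow>\<^sub>L complex)"
  assume D: "derivation D \<and> cyclic D \<and> continuous_on UNIV D"
  have "approximately_inner (pullback dp_in1 D)" "approximately_inner (pullback dp_in2 D)"
    using assms(1,2) D derivation_pullback cyclic_pullback continuous_on_pullback algebra_hom_dp
    unfolding approximately_cyclic_amenable_def by blast+
  then show "approximately_inner D"
    using D assms(3)
    by (subst derivation_dp_decompose)
      (auto intro!: approximately_inner_add approximately_inner_pullback)
qed

section \<open>Necessity of a dense square\<close>

text \<open>A constant net, realized by the filter on a one-point type.\<close>

lemma is_inner_imp_approximately_inner: "is_inner D \<Longrightarrow> approximately_inner D"
  unfolding is_inner_def by (auto intro: approximately_innerI[where F = "principal {()}"]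
      simp: principal_eq_bot_iff)

text \<open>Lets density of a square, derived from the approximate notion, serve both
  equivalences.\<close>

lemma cyclic_amenable_imp_approximately:
  "cyclic_amenable TYPE('a::complex_banach_algebra) \<Longrightarrow> approximately_cyclic_amenable TYPE('a)"
  unfolding cyclic_amenable_def approximately_cyclic_amenable_def
  using is_inner_imp_approximately_inner by blast

text \<open>Every inner derivation has value f (w * z) - f (z * w) = 0 here, so \<open>D z w\<close>
  is bounded by the approximation error at \<open>z\<close> times \<open>norm w\<close>.\<close>

lemma approximately_inner_annihilator_eq_0:
  assumes "approximately_inner D" "z * w = 0" "w * z = 0"
  shows "D z w = 0"
proof -
  obtain F where F: "F \<noteq> bot" "((\<lambda>f. norm (D z - inner_derivation f z)) \<longlongrightarrow> 0) F"
    using assms(1) unfolding approximately_inner_def by blast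
  have "norm (D z w) \<le> norm (D z - inner_derivation f z) * norm w" for f
    using norm_blinfun[of "D z - inner_derivation f z" w] assms(2,3)
    by (simp add: inner_derivation_def blinfun.bilinear_simps)
  then have "norm (D z w) \<le> 0"
    by (intro tendsto_lowerbound[OF tendsto_mult_left_zero[OF F(2), of "norm w"]
          always_eventually F(1)] allI)
  then show ?thesis
    by simp
qed

lemma mult_mem_square: "a * c \<in> square"
  unfolding square_def by (rule complex_vector.span_base) auto

lemma square_dense_if_approximately_cyclic_amenable_dp:
  assumes amenable:
    "approximately_cyclic_amenable TYPE('a::complex_banach_algebra \<oplus> 'b::complex_banach_algebra)"
  shows "square_dense TYPE('a) \<or> square_dense TYPE('b)"
proof (rule ccontr)
  assume not_dense: "\<not> ?thesis"
  obtain f and a :: 'a where f: "f \<in> dual" "\<And>x. x \<in> square \<Longrightarrow> f x = 0" "f a \<noteq> 0"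
    using separating_functional[of "square :: 'a set"] not_dense
    by (auto simp: square_dense_def square_def)
  obtain g and b :: 'b where g: "g \<in> dual" "\<And>y. y \<in> square \<Longrightarrow> g y = 0" "g b \<noteq> 0"
    using separating_functional[of "square :: 'b set"] not_dense
    by (auto simp: square_dense_def square_def)
  \<comment> \<open>Composing with multiplication by a scalar expresses the rank-one terms through
    bounded linear operations, from which continuity in \<open>z\<close> can be read off.\<close>
  define D :: "('a \<oplus> 'b) \<Rightarrow> (('a \<oplus> 'b) \<Rightarrow>\<^sub>L complex)" where
    "D = (\<lambda>z. (blinfun_mult_right (f (dp_proj1 z)) o\<^sub>L (g o\<^sub>L dp_proj2))
      - (blinfun_mult_right (g (dp_proj2 z)) o\<^sub>L (f o\<^sub>L dp_proj1)))"
  have D_apply: "D z w = f (dp_fst z) * g (dp_snd w) - g (dp_snd z) * f (dp_fst w)" for z w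
    by (simp add: D_def blinfun.bilinear_simps)
  have f0: "f (x * y) = 0" for x y
    by (simp add: f(2) mult_mem_square)
  have g0: "g (x * y) = 0" for x y
    by (simp add: g(2) mult_mem_square)
  \<comment> \<open>Both sides of the Leibniz rule vanish, because every term evaluates
    \<open>f\<close> or \<open>g\<close> at a product.\<close>
  have "derivation D"
    using f(1) g(1) unfolding derivation_def
    by (auto simp: dual_def D_apply dp_alg_defs scaleC_direct_product_def f0 g0
        blinfun.bilinear_simps algebra_simps intro!: blinfun_eqI)
  moreover have "cyclic D"
    by (simp add: cyclic_def D_apply)
  moreover have "continuous_on UNIV D"
    unfolding D_def
    by (intro continuous_intros bounded_linear.continuous_on[OF bounded_linear_blinfun_mult_right])
  ultimately have "approximately_inner D"
    using amenable by (simp add: approximately_cyclic_amenable_def)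
  \<comment> \<open>The two elements annihilate each other, yet the value of \<open>D\<close> is
    \<open>f a * g b\<close>, a product of nonzero numbers.\<close>
  then have "D (DP a 0) (DP 0 b) = 0"
    by (rule approximately_inner_annihilator_eq_0) (simp_all add: dp_alg_defs)
  then show False
    using f(3) g(3) by (simp add: D_apply blinfun.bilinear_simps)
qed

theorem corollary3p3:
  shows "(cyclic_amenable TYPE('a::complex_banach_algebra \<oplus> 'b::complex_banach_algebra) \<longleftrightarrow>
        cyclic_amenable TYPE('a) \<and> cyclic_amenable TYPE('b) \<and>
        (square_dense TYPE('a) \<or> square_dense TYPE('b))) \<and>
      (approximately_cyclic_amenable TYPE('a \<oplus> 'b) \<longleftrightarrow>
        approximately_cyclic_amenable TYPE('a) \<and> approximately_cyclic_amenable TYPE('b) \<and>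
        (square_dense TYPE('a) \<or> square_dense TYPE('b)))"
proof -
  \<comment> \<open>Each factor is a retract of the product; the index pairs (3,1) and (4,2) match
    each embedding with its projection.\<close>
  have "cyclic_amenable TYPE('a) \<and> cyclic_amenable TYPE('b)"
    if "cyclic_amenable TYPE('a \<oplus> 'b)"
    using cyclic_amenable_retract[OF that algebra_hom_dp(3,1)]
      cyclic_amenable_retract[OF that algebra_hom_dp(4,2)] by simp
  moreover have "approximately_cyclic_amenable TYPE('a) \<and> approximately_cyclic_amenable TYPE('b)"
    if "approximately_cyclic_amenable TYPE('a \<oplus> 'b)"
    using approximately_cyclic_amenable_retract[OF that algebra_hom_dp(3,1)]
      approximately_cyclic_amenable_retract[OF that algebra_hom_dp(4,2)] by simp
  moreover note cyclic_amenable_dp[where 'a = 'a and 'b = 'b]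
    approximately_cyclic_amenable_dp[where 'a = 'a and 'b = 'b]
    square_dense_if_approximately_cyclic_amenable_dp[where 'a = 'a and 'b = 'b]
    cyclic_amenable_imp_approximately[where 'a = "'a \<oplus> 'b"]
  ultimately show ?thesis
    by blast
qed

end
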